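(* For any loopless graph $H$ on $h$ vertices and any $g\ge1$, the $1$-skeleton of $\pi\mathrm{Hom}(K_g,H)$ (inflated by the factor $g$) is a subcomplex of the $1$-skeleton of the hypersimplex $\Delta(h,g)$.
   Context: Graphs are finite and undirected, $V(K_g)=[g]$, $V(H)=[h]$. $\Delta_{V(H)}=\mathrm{conv}\{e_1,\dots,e_h\}\subset\mathbb R^h$; subsets of $V(H)$ are identified with faces of $\Delta_{V(H)}$. $\mathrm{Hom}(K_g,H)$ is the polytopal complex of all cells $\sigma=\times_{i\in[g]}\sigma_i$ (all $\sigma_i\subset V(H)$ nonempty) of $\times_{i\in[g]}\Delta_{V(H)}$ such that for all $i\ne j$ every $(u,v)\in\sigma_i\times\sigma_j$ is an edge of $H$. Its canonical projection is $\pi\mathrm{Hom}(K_g,H)=\{\pi(\sigma):\sigma\text{ a cell of }\mathrm{Hom}(K_g,H)\}$, where $\pi(\sigma)=\frac1g(\sigma_1+\dots+\sigma_g)\subset\mathbb R^h$ (Minkowski sum); inflating by $g$ replaces $\pi(\sigma)$ by $\sigma_1+\dots+\sigma_g$. The $1$-skeleton of this family consists of all vertices and edges of its members. The hypersimplex $\Delta(h,g)\subset\mathbb R^h$ is the convex hull of all $0/1$-vectors of length $h$ with exactly $g$ ones. *)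

theory Defs
  imports "HOL-Analysis.Analysis"
begin

text \<open>
  A graph \<open>H\<close> on \<open>h\<close> vertices is its adjacency relation on a finite type \<open>'n\<close>, with vertex set
  \<open>UNIV :: 'n set\<close> and \<open>h = CARD('n)\<close>; undirected means \<^term>\<open>sym H\<close>, loopless \<^term>\<open>irrefl H\<close>.
\<close>

definition simplex_face :: "'n::finite set \<Rightarrow> (real^'n) set" where
  "simplex_face S = convex hull ((\<lambda>v. axis v 1) ` S)"

text \<open>
  A cell \<open>\<sigma>\<^sub>1 \<times> \<dots> \<times> \<sigma>\<^sub>g\<close> is the tuple of the vertex sets of its factors, as an
  extensional function on \<open>{1..g}\<close>.
\<close>

definition Hom_complete :: "nat \<Rightarrow> ('n::finite \<times> 'n) set \<Rightarrow> (nat \<Rightarrow> 'n set) set" where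
  "Hom_complete g H =
     {\<sigma> \<in> {1..g} \<rightarrow>\<^sub>E {S. S \<noteq> {}}. \<forall>i\<in>{1..g}. \<forall>j\<in>{1..g}. i \<noteq> j \<longrightarrow> \<sigma> i \<times> \<sigma> j \<subseteq> H}"

text \<open>The sum of sets below is the Minkowski sum of \<^theory>\<open>HOL-Library.Set_Algebras\<close>.\<close>

definition cell_projection :: "nat \<Rightarrow> (nat \<Rightarrow> 'n::finite set) \<Rightarrow> (real^'n) set" where
  "cell_projection g \<sigma> = (\<lambda>x. (1 / real g) *\<^sub>R x) ` (\<Sum>i\<in>{1..g}. simplex_face (\<sigma> i))"

definition proj_Hom_complete :: "nat \<Rightarrow> ('n::finite \<times> 'n) set \<Rightarrow> (real^'n) set set" where
  "proj_Hom_complete g H = cell_projection g ` Hom_complete g H"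

definition inflate :: "real \<Rightarrow> 'a::real_vector set set \<Rightarrow> 'a set set" where
  "inflate c \<F> = (\<lambda>P. (\<lambda>x. c *\<^sub>R x) ` P) ` \<F>"

definition hypersimplex :: "nat \<Rightarrow> (real^'n::finite) set" where
  "hypersimplex g = convex hull {x. (\<forall>i. x $ i \<in> {0, 1}) \<and> card {i. x $ i = 1} = g}"

definition one_skeleton :: "'a::euclidean_space set set \<Rightarrow> 'a set set" where
  "one_skeleton \<F> = {{x} | x P. P \<in> \<F> \<and> x extreme_point_of P} \<union> {e. \<exists>P\<in>\<F>. e edge_of P}"

text \<open>The empty face is not counted as a cell of a complex.\<close>

definition polytopal_complex :: "'a::euclidean_space set set \<Rightarrow> bool" where
  "polytopal_complex K \<longleftrightarrow>
     finite K \<and>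
     (\<forall>P\<in>K. polytope P \<and> P \<noteq> {}) \<and>
     (\<forall>P\<in>K. \<forall>F. F face_of P \<and> F \<noteq> {} \<longrightarrow> F \<in> K) \<and>
     (\<forall>P\<in>K. \<forall>Q\<in>K. P \<inter> Q face_of P \<and> P \<inter> Q face_of Q)"

definition subcomplex_of :: "'a::euclidean_space set set \<Rightarrow> 'a set set \<Rightarrow> bool" where
  "subcomplex_of K L \<longleftrightarrow> polytopal_complex K \<and> polytopal_complex L \<and> K \<subseteq> L"

end

theory Submission
  imports Defs
begin

text \<open>
  Since \<open>H\<close> is loopless, the factors of a cell \<open>\<sigma>\<close> are pairwise disjoint, so the vertices of
  \<open>\<sigma>\<^sub>1 + \<dots> + \<sigma>\<^sub>g\<close> are indicator vectors of transversals of \<open>\<sigma>\<close>. If two endpoints of an edge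
  differed in two factors, exchanging one of the differing choices between them would give
  another pair of points of the cell with the same midpoint, which an edge does not allow. Hence
  the endpoints differ by replacing a single vertex, and such pairs span edges of the hypersimplex.
\<close>

section \<open>Skeleta of families of polytopes\<close>

text \<open>Vertices are exactly the faces of affine dimension 0. The uniform description lets
  transitivity of faces treat vertices and edges together.\<close>

lemma one_skeleton_eq: "one_skeleton \<F> = {e. e \<noteq> {} \<and> aff_dim e \<le> 1 \<and> (\<exists>P\<in>\<F>. e face_of P)}"
proof -
  have dim: "e \<noteq> {} \<and> aff_dim e \<le> 1 \<longleftrightarrow> aff_dim e = 1 \<or> (\<exists>x. e = {x})" for e :: "'a set"
  proof -
    have "e \<noteq> {} \<longleftrightarrow> aff_dim e \<ge> 0"
      by (meson aff_dim_negative_iff not_less)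
    then have "e \<noteq> {} \<and> aff_dim e \<le> 1 \<longleftrightarrow> aff_dim e = 1 \<or> aff_dim e = 0"
      by linarith
    then show ?thesis by (simp add: aff_dim_eq_0)
  qed
  show ?thesis
    unfolding one_skeleton_def edge_of_def face_of_singleton[symmetric] conj_assoc[symmetric] dim
    by blast
qed

lemma face_of_one_skeleton:
  assumes "e \<in> one_skeleton \<F>" "f face_of e" "f \<noteq> {}"
  shows "f \<in> one_skeleton \<F>"
proof -
  obtain P where P: "P \<in> \<F>" "e face_of P" "aff_dim e \<le> 1"
    using assms(1) unfolding one_skeleton_eq by blast
  moreover have "f face_of P" using assms(2) P(2) by (rule face_of_trans)
  moreover have "aff_dim f \<le> aff_dim e"
    using assms(2) by (intro aff_dim_subset face_of_imp_subset)
  ultimately show ?thesis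
    using assms(3) unfolding one_skeleton_eq by auto
qed

lemma polytopal_complex_one_skeleton_polytope:
  assumes "polytope Q"
  shows "polytopal_complex (one_skeleton {Q})"
  unfolding polytopal_complex_def
proof (intro conjI ballI allI impI)
  have "one_skeleton {Q} \<subseteq> {F. F face_of Q}"
    unfolding one_skeleton_eq by auto
  then show "finite (one_skeleton {Q})"
    using finite_polytope_faces[OF assms] finite_subset by blast
next
  fix P assume "P \<in> one_skeleton {Q}"
  then show "polytope P" "P \<noteq> {}"
    unfolding one_skeleton_eq using face_of_polytope_polytope[OF assms] by auto
next
  fix P F assume "P \<in> one_skeleton {Q}" "F face_of P \<and> F \<noteq> {}"
  then show "F \<in> one_skeleton {Q}"
    using face_of_one_skeleton by blast
next
  fix P R assume PR: "P \<in> one_skeleton {Q}" "R \<in> one_skeleton {Q}"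
  then have "P \<inter> R face_of Q"
    unfolding one_skeleton_eq by (auto intro: face_of_Int)
  then show "P \<inter> R face_of P" "P \<inter> R face_of R"
    using PR unfolding one_skeleton_eq by (auto intro: face_of_subset dest: face_of_imp_subset)
qed

text \<open>Reduces the theorem to an inclusion: finiteness, polytopality and the intersection
  property pass from \<open>L\<close> to subsets, while closure under faces holds in every
  1-skeleton.\<close>

lemma subcomplex_of_one_skeleton:
  assumes "polytopal_complex L" "one_skeleton \<F> \<subseteq> L"
  shows "subcomplex_of (one_skeleton \<F>) L"
proof -
  have "polytopal_complex (one_skeleton \<F>)"
    unfolding polytopal_complex_def
  proof (intro conjI ballI allI impI)
    show "finite (one_skeleton \<F>)"
      using assms finite_subset unfolding polytopal_complex_def by blast
  next
    fix P assume "P \<in> one_skeleton \<F>"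
    then have "P \<in> L" using assms(2) by (rule set_mp[rotated])
    then show "polytope P" "P \<noteq> {}"
      using assms(1) unfolding polytopal_complex_def by simp_all
  next
    fix P F assume "P \<in> one_skeleton \<F>" "F face_of P \<and> F \<noteq> {}"
    then show "F \<in> one_skeleton \<F>"
      by (elim conjE) (rule face_of_one_skeleton)
  next
    fix P R assume "P \<in> one_skeleton \<F>" "R \<in> one_skeleton \<F>"
    then have "P \<in> L" "R \<in> L" using assms(2) by (simp_all only: subset_iff)
    moreover have "\<forall>P\<in>L. \<forall>Q\<in>L. P \<inter> Q face_of P \<and> P \<inter> Q face_of Q"
      using assms(1) unfolding polytopal_complex_def by (elim conjE)
    ultimately show "P \<inter> R face_of P" "P \<inter> R face_of R" by simp_all
  qed
  then show ?thesis
    using assms unfolding subcomplex_of_def by (intro conjI)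
qed

lemma inflate_proj_Hom_complete:
  assumes "g \<ge> 1"
  shows "inflate (real g) (proj_Hom_complete g H) =
           (\<lambda>\<sigma>. \<Sum>i\<in>{1..g}. simplex_face (\<sigma> i)) ` Hom_complete g H"
  using assms
  by (simp add: inflate_def proj_Hom_complete_def cell_projection_def image_image)

section \<open>Indicator vectors and the hypersimplex\<close>

definition indicator_vec :: "'n set \<Rightarrow> real^'n::finite" where
  "indicator_vec S = (\<chi> k. if k \<in> S then 1 else 0)"

lemma indicator_vec_nth [simp]: "indicator_vec S $ k = (if k \<in> S then 1 else 0)"
  by (simp add: indicator_vec_def)

lemma indicator_vec_eq_iff [simp]: "indicator_vec S = indicator_vec T \<longleftrightarrow> S = T"
  by (auto simp: vec_eq_iff split: if_splits)

lemma zero_one_vec_eq_indicator_vec: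
  shows "{x :: real^'n. (\<forall>i. x $ i \<in> {0, 1}) \<and> card {i. x $ i = 1} = g} =
         indicator_vec ` {S. card S = g}" (is "?L = ?R")
proof
  show "?L \<subseteq> ?R"
  proof
    fix x :: "real^'n" assume x: "x \<in> ?L"
    then have "x = indicator_vec {i. x $ i = 1}"
      by (auto simp: vec_eq_iff)
    then show "x \<in> ?R" using x by blast
  qed
  show "?R \<subseteq> ?L" by auto
qed

lemma hypersimplex_eq: "hypersimplex g = convex hull (indicator_vec ` {S. card S = g})"
  unfolding hypersimplex_def zero_one_vec_eq_indicator_vec ..

lemma polytope_hypersimplex: "polytope (hypersimplex g)"
  unfolding hypersimplex_eq by (intro polytope_convex_hull finite_imageI) simp

lemma indicator_vec_in_hypersimplex: "card S = g \<Longrightarrow> indicator_vec S \<in> hypersimplex g"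
  unfolding hypersimplex_eq by (rule hull_inc) simp

text \<open>The constraints define a convex set containing all generators, hence containing their
  hull.\<close>

lemma hypersimplex_bounds:
  assumes "x \<in> hypersimplex g"
  shows "0 \<le> x $ k" "x $ k \<le> 1" "(\<Sum>k\<in>UNIV. x $ k) = real g"
proof -
  let ?C = "{x :: real^'a. (\<forall>k. 0 \<le> x $ k \<and> x $ k \<le> 1) \<and> (\<Sum>k\<in>UNIV. x $ k) = real g}"
  have "convex ?C"
    unfolding convex_def
    by (auto simp: sum.distrib sum_distrib_left[symmetric] convex_bound_le
        simp flip: distrib_right)
  moreover have "indicator_vec ` {S. card S = g} \<subseteq> ?C"
    by (auto simp: sum.If_cases)
  ultimately have "hypersimplex g \<subseteq> ?C"
    unfolding hypersimplex_eq by (intro hull_minimal)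
  then show "0 \<le> x $ k" "x $ k \<le> 1" "(\<Sum>k\<in>UNIV. x $ k) = real g"
    using assms by auto
qed

text \<open>Every coordinate of the point is an end of the interval [0, 1], so a proper convex
  combination can attain it only if both points share that coordinate.\<close>

lemma extreme_point_hypersimplex:
  assumes "card S = g"
  shows "indicator_vec S extreme_point_of hypersimplex g"
proof -
  have "y = indicator_vec S \<and> z = indicator_vec S"
    if y: "y \<in> hypersimplex g" and z: "z \<in> hypersimplex g" and seg: "indicator_vec S \<in> open_segment y z"
    for y z
  proof -
    obtain u where u: "0 < u" "u < 1" "indicator_vec S = (1 - u) *\<^sub>R y + u *\<^sub>R z"
      using seg by (auto simp: in_segment)
    have "y $ k = indicator_vec S $ k \<and> z $ k = indicator_vec S $ k" for k
    proof -
      have e: "indicator_vec S $ k = (1 - u) * y $ k + u * z $ k"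
        by (simp add: u(3))
      note b = hypersimplex_bounds(1,2)[OF y, of k] hypersimplex_bounds(1,2)[OF z, of k]
      show ?thesis
      proof (cases "k \<in> S")
        case True
        then have "(1 - u) * (1 - y $ k) + u * (1 - z $ k) = 0"
          using e by (simp add: algebra_simps)
        moreover have "0 \<le> (1 - u) * (1 - y $ k)" "0 \<le> u * (1 - z $ k)"
          using b u by auto
        ultimately have "(1 - u) * (1 - y $ k) = 0" "u * (1 - z $ k) = 0" by linarith+
        then show ?thesis using True u by simp
      next
        case False
        then have "(1 - u) * y $ k + u * z $ k = 0" using e by simp
        moreover have "0 \<le> (1 - u) * y $ k" "0 \<le> u * z $ k"
          using b u by auto
        ultimately have "(1 - u) * y $ k = 0" "u * z $ k = 0" by linarith+
        then show ?thesis using False u by simp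
      qed
    qed
    then show ?thesis by (simp add: vec_eq_iff)
  qed
  then have "indicator_vec S \<notin> open_segment y z"
    if "y \<in> hypersimplex g" "z \<in> hypersimplex g" for y z
    using that by fastforce
  then show ?thesis
    unfolding extreme_point_of_def using indicator_vec_in_hypersimplex[OF assms] by blast
qed

text \<open>The segment is cut out by a supporting hyperplane whose normal ignores the two exchanged
  coordinates \<open>a\<close> and \<open>b\<close>.\<close>

lemma segment_edge_of_hypersimplex:
  assumes S: "card S = g" and a: "a \<in> S" and b: "b \<notin> S"
  shows "closed_segment (indicator_vec S) (indicator_vec (insert b (S - {a}))) edge_of hypersimplex g"
    (is "closed_segment ?x ?y edge_of ?Q")
proof -
  \<comment> \<open>The entries of \<open>w\<close> are 1 on \<open>S - {a}\<close>, 0 at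
    \<open>a\<close> and \<open>b\<close>, and -1 elsewhere.\<close>
  define w where "w = indicator_vec (S - {a}) - indicator_vec (- insert b S)"
  let ?m = "real (card (S - {a}))"
  let ?F = "?Q \<inter> {z. w \<bullet> z = ?m}"
  \<comment> \<open>With the bound written as a coordinate sum, the supporting inequality and its
    equality case can both be checked termwise.\<close>
  have m: "(\<Sum>k\<in>UNIV. indicator_vec (S - {a}) $ k) = ?m"
    by (simp add: sum.If_cases set_diff_eq)
  have le: "w $ k * z $ k \<le> indicator_vec (S - {a}) $ k" if "z \<in> ?Q" for z k
    using hypersimplex_bounds[OF that] by (auto simp: w_def)
  have F: "?F face_of ?Q"
  proof (rule face_of_Int_supporting_hyperplane_le)
    show "convex ?Q" using polytope_hypersimplex polytope_imp_convex by blast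
    show "w \<bullet> z \<le> ?m" if "z \<in> ?Q" for z
      unfolding m[symmetric] inner_vec_def using le[OF that] by (simp add: sum_mono)
  qed
  have cardT: "card (insert b (S - {a})) = g"
    using S a b by (metis card.insert card.remove Diff_iff finite)
  have "?x \<in> ?F" "?y \<in> ?F"
    using indicator_vec_in_hypersimplex[OF S] indicator_vec_in_hypersimplex[OF cardT] b
    unfolding m[symmetric] inner_vec_def by (auto simp: w_def intro!: sum.cong)
  then have "closed_segment ?x ?y \<subseteq> ?F"
    using closed_segment_subset[OF _ _ face_of_imp_convex[OF F]] by simp
  moreover have "?F \<subseteq> closed_segment ?x ?y"
  proof
    fix z assume z: "z \<in> ?F"
    then have zQ: "z \<in> ?Q" by simp
    have "w $ k * z $ k = indicator_vec (S - {a}) $ k" for k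
    proof (rule sum_mono_inv[of "\<lambda>k. w $ k * z $ k" UNIV])
      show "(\<Sum>k\<in>UNIV. w $ k * z $ k) = (\<Sum>k\<in>UNIV. indicator_vec (S - {a}) $ k)"
        using z unfolding m by (simp add: inner_vec_def)
    qed (use le[OF zQ] in auto)
    then have eq: "w $ k * z $ k = (if k \<in> S - {a} then 1 else 0)" for k
      by simp
    have z1: "z $ k = 1" if "k \<in> S" "k \<noteq> a" for k
      using eq[of k] that by (simp add: w_def)
    have z0: "z $ k = 0" if "k \<notin> S" "k \<noteq> b" for k
      using eq[of k] that by (simp add: w_def)
    \<comment> \<open>Both points have coordinate sum \<open>g\<close> and agree off
      \<open>a\<close> and \<open>b\<close>, which leaves \<open>z $ b\<close> as the only free
      parameter.\<close>
    have "(\<Sum>k\<in>UNIV. z $ k - ?x $ k) = 0"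
      using hypersimplex_bounds(3)[OF zQ] hypersimplex_bounds(3)[OF indicator_vec_in_hypersimplex[OF S]]
      by (simp only: sum_subtractf)
    also have "(\<Sum>k\<in>UNIV. z $ k - ?x $ k) = (\<Sum>k\<in>{a,b}. z $ k - ?x $ k)"
      by (rule sum.mono_neutral_right) (auto simp: z0 z1)
    also have "\<dots> = z $ a - 1 + z $ b"
      using a b by (subst sum.insert) auto
    finally have za: "z $ a = 1 - z $ b" by simp
    have "z = (1 - z $ b) *\<^sub>R ?x + (z $ b) *\<^sub>R ?y"
      using a b by (auto simp: vec_eq_iff z0 z1 za)
    then show "z \<in> closed_segment ?x ?y"
      using hypersimplex_bounds[OF zQ] unfolding in_segment by blast
  qed
  ultimately have "?F = closed_segment ?x ?y" by blast
  moreover have "?x \<noteq> ?y" using b by auto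
  ultimately show ?thesis
    using F by (simp add: edge_of_def aff_dim_2 segment_convex_hull aff_dim_convex_hull)
qed

section \<open>Sums of simplices with disjoint vertex sets\<close>

locale disjoint_cell =
  fixes I :: "'i set" and \<sigma> :: "'i \<Rightarrow> 'n::finite set"
  assumes finite_index: "finite I"
    and disjoint: "\<And>i j. i \<in> I \<Longrightarrow> j \<in> I \<Longrightarrow> i \<noteq> j \<Longrightarrow> \<sigma> i \<inter> \<sigma> j = {}"
begin

abbreviation cell :: "(real^'n) set" where
  "cell \<equiv> \<Sum>i\<in>I. simplex_face (\<sigma> i)"

lemma inj_on_transversal:
  assumes "v \<in> Pi I \<sigma>"
  shows "inj_on v I"
  using assms disjoint by (fastforce simp: inj_on_def)

text \<open>Distinct indices choose distinct vertices, so no coordinate is counted twice.\<close>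

lemma sum_axis_transversal:
  assumes "v \<in> Pi I \<sigma>"
  shows "(\<Sum>i\<in>I. axis (v i) 1) = indicator_vec (v ` I)"
proof -
  have "(\<Sum>i\<in>I. axis (v i) (1::real)) = (\<Sum>s\<in>v ` I. axis s 1)"
    using inj_on_transversal[OF assms] by (simp add: sum.reindex)
  also have "\<dots> = indicator_vec (v ` I)"
    using finite_index by (auto simp: vec_eq_iff axis_def)
  finally show ?thesis .
qed

text \<open>Convex hulls commute with Minkowski sums, so the cell is spanned by the sums of one
  vertex from each factor.\<close>

lemma cell_eq: "cell = convex hull ((\<lambda>v. indicator_vec (v ` I)) ` Pi I \<sigma>)"
proof -
  have "(\<Sum>i\<in>I. (\<lambda>v. axis v (1::real)) ` \<sigma> i) = (\<lambda>v. indicator_vec (v ` I)) ` Pi I \<sigma>"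
    (is "?L = ?R")
  proof
    show "?L \<subseteq> ?R"
    proof
      fix x assume "x \<in> ?L"
      then obtain s where s: "x = sum s I" "\<forall>i\<in>I. s i \<in> (\<lambda>v. axis v 1) ` \<sigma> i"
        by (auto simp: set_sum_alt[OF finite_index])
      then obtain v where v: "\<forall>i\<in>I. v i \<in> \<sigma> i \<and> s i = axis (v i) 1"
        unfolding image_iff by metis
      then have "v \<in> Pi I \<sigma>" by auto
      moreover have "x = (\<Sum>i\<in>I. axis (v i) 1)" using s v by simp
      ultimately show "x \<in> ?R" using sum_axis_transversal by auto
    qed
    show "?R \<subseteq> ?L"
      by (auto simp: set_sum_alt[OF finite_index] sum_axis_transversal[symmetric])
  qed
  then show ?thesis
    unfolding simplex_face_def convex_hull_set_sum[symmetric] by simp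
qed

lemma indicator_vec_in_cell: "v \<in> Pi I \<sigma> \<Longrightarrow> indicator_vec (v ` I) \<in> cell"
  unfolding cell_eq by (rule hull_inc) simp

lemma polytope_cell: "polytope cell"
proof -
  \<comment> \<open>\<open>Pi I \<sigma>\<close> need not be finite, since its functions are
    arbitrary outside \<open>I\<close>; finiteness comes from the finitely many subsets of the
    vertex type.\<close>
  have "(\<lambda>v. indicator_vec (v ` I)) ` Pi I \<sigma> \<subseteq> range (indicator_vec :: 'n set \<Rightarrow> real^'n)"
    by auto
  then show ?thesis
    unfolding cell_eq by (meson polytope_convex_hull finite finite_imageI finite_subset)
qed

lemma extreme_point_cell:
  assumes "x extreme_point_of cell"
  obtains v where "v \<in> Pi I \<sigma>" "x = indicator_vec (v ` I)"
  using assms extreme_point_of_convex_hull unfolding cell_eq by blast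

text \<open>The exchange is made at a single index where the endpoints differ; the exchanged
  transversal lies on the edge and must be the second endpoint.\<close>

lemma edge_of_cell:
  assumes "e edge_of cell"
  obtains S a b where "card S = card I" "a \<in> S" "b \<notin> S"
    "e = closed_segment (indicator_vec S) (indicator_vec (insert b (S - {a})))"
proof -
  have face: "e face_of cell" and dim: "aff_dim e = 1"
    using assms by (auto simp: edge_of_def)
  have "polytope e" using face face_of_polytope_polytope[OF polytope_cell] by blast
  moreover have "e \<noteq> {}" using dim by auto
  \<comment> \<open>A compact convex collinear set is a segment.\<close>
  ultimately obtain x y where e: "e = closed_segment x y"
    using compact_convex_collinear_segment[of e] dim
    by (auto simp: collinear_aff_dim polytope_imp_compact polytope_imp_convex)
  have "x extreme_point_of e" "y extreme_point_of e"
    unfolding e by (simp_all add: extreme_point_of_segment)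
  then have "x extreme_point_of cell" "y extreme_point_of cell"
    using face by (simp_all add: extreme_point_of_face)
  then obtain v w where v: "v \<in> Pi I \<sigma>" "x = indicator_vec (v ` I)"
    and w: "w \<in> Pi I \<sigma>" "y = indicator_vec (w ` I)"
    using extreme_point_cell by metis
  have "x \<noteq> y" using dim e by auto
  then obtain i where i: "i \<in> I" "v i \<noteq> w i"
    using v w by (metis image_cong)
  \<comment> \<open>By disjointness \<open>v i\<close> could be chosen by \<open>w\<close> only at
    the index \<open>i\<close>, where the two differ; likewise for \<open>w i\<close>.\<close>
  have vi: "v i \<notin> w ` I" and wi: "w i \<notin> v ` I"
    using i v(1) w(1) disjoint by (fastforce simp: Pi_iff)+
  define v' w' where "v' = v(i := w i)" and "w' = w(i := v i)"
  have v': "v' \<in> Pi I \<sigma>" and w': "w' \<in> Pi I \<sigma>"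
    using v(1) w(1) by (auto simp: v'_def w'_def)
  let ?x = "indicator_vec (v' ` I) :: real^'n" and ?y = "indicator_vec (w' ` I) :: real^'n"
  have "?x + ?y = x + y"
    unfolding v(2) w(2) sum_axis_transversal[OF v', symmetric] sum_axis_transversal[OF w', symmetric]
      sum_axis_transversal[OF v(1), symmetric] sum_axis_transversal[OF w(1), symmetric]
      sum.distrib[symmetric]
    by (rule sum.cong) (auto simp: v'_def w'_def)
  then have "midpoint ?x ?y \<in> e"
    unfolding e by (metis midpoint_def midpoint_in_closed_segment)
  \<comment> \<open>If \<open>?x\<close> and \<open>?y\<close> coincide, the midpoint is
    \<open>?x\<close> itself. Otherwise it lies in their open segment, and a face containing it
    contains both.\<close>
  then have "?x \<in> e"
    using face indicator_vec_in_cell[OF v'] indicator_vec_in_cell[OF w']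
    unfolding face_of_def
    by (metis midpoint_eq_endpoint(1) midpoint_in_open_segment)
  then obtain u where u: "?x = (1 - u) *\<^sub>R x + u *\<^sub>R y"
    unfolding e by (auto simp: in_segment)
  have "w i \<in> v' ` I" using i by (auto simp: v'_def image_iff)
  \<comment> \<open>At coordinate \<open>w i\<close> the values of \<open>x\<close>,
    \<open>y\<close> and \<open>?x\<close> are 0, 1 and 1.\<close>
  then have "u = 1"
    using arg_cong[OF u, of "\<lambda>z. z $ w i"] wi i(1) by (simp add: v(2) w(2))
  then have "y = ?x" using u by simp
  moreover have "v' ` I = insert (w i) (v ` I - {v i})"
    using i inj_on_transversal[OF v(1)] by (auto simp: v'_def inj_on_def)
  ultimately have "e = closed_segment (indicator_vec (v ` I))
      (indicator_vec (insert (w i) (v ` I - {v i})))"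
    using e v(2) by simp
  then show thesis
    using that[of "v ` I" "v i" "w i"] wi i(1) card_image[OF inj_on_transversal[OF v(1)]] by blast
qed

lemma one_skeleton_cell_subset: "one_skeleton {cell} \<subseteq> one_skeleton {hypersimplex (card I)}"
proof -
  have "x extreme_point_of hypersimplex (card I)" if "x extreme_point_of cell" for x
    using extreme_point_cell[OF that] inj_on_transversal
    by (metis card_image extreme_point_hypersimplex)
  moreover have "e edge_of hypersimplex (card I)" if "e edge_of cell" for e
    using edge_of_cell[OF that] segment_edge_of_hypersimplex by metis
  ultimately show ?thesis
    unfolding one_skeleton_def by auto
qed

end

theorem proposition3p5:
  fixes H :: "('n::finite \<times> 'n) set" and g :: nat
  assumes "sym H" and "irrefl H" and "g \<ge> 1"
  shows "subcomplex_of (one_skeleton (inflate (real g) (proj_Hom_complete g H)))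
           (one_skeleton {hypersimplex g :: (real^'n) set})"
proof (rule subcomplex_of_one_skeleton)
  show "polytopal_complex (one_skeleton {hypersimplex g :: (real^'n) set})"
    by (rule polytopal_complex_one_skeleton_polytope[OF polytope_hypersimplex])
  have "one_skeleton {\<Sum>i\<in>{1..g}. simplex_face (\<sigma> i)} \<subseteq> one_skeleton {hypersimplex g :: (real^'n) set}"
    if "\<sigma> \<in> Hom_complete g H" for \<sigma>
  proof -
    \<comment> \<open>A vertex common to two factors would be adjacent to itself.\<close>
    interpret disjoint_cell "{1..g}" \<sigma>
      using that \<open>irrefl H\<close> by unfold_locales (simp, unfold Hom_complete_def irrefl_def, blast)
    show ?thesis using one_skeleton_cell_subset by simp
  qed
  \<comment> \<open>The 1-skeleton of a family is the union of those of its members, so the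
    inclusion for single cells suffices.\<close>
  then show "one_skeleton (inflate (real g) (proj_Hom_complete g H))
      \<subseteq> one_skeleton {hypersimplex g :: (real^'n) set}"
    unfolding inflate_proj_Hom_complete[OF \<open>g \<ge> 1\<close>] one_skeleton_eq by blast
qed

end
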